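(* Let $S=(a_1,\dots,a_n),(b_1,\dots,b_{n'})$ be a sequence of positive integers and let $F=F_E\cup F_N$ be a set of fixed edges and non-edges that does not contain a matching of size $3$. Then both the $F$-ignoring swap algorithm and the $F$-ignoring Curveball algorithm, started in any $F$-fixed realisation of $S$, sample $F$-fixed realisations of $S$ uniformly at random for $t\to\infty$; that is, the distribution of the realisation reached after $t$ steps converges, as $t\to\infty$, to the uniform distribution on the set of all $F$-fixed realisations of $S$.
   Context: Let $V=\{v_1,\dots,v_n\}$ and $U=\{u_1,\dots,u_{n'}\}$ be disjoint finite vertex sets. $F_E$ and $F_N$ are sets of vertex pairs $\{v_i,u_j\}$ with $v_i\in V$, $u_j\in U$ (fixed edges and fixed non-edges), and $F=F_E\cup F_N$. "$F$ contains a matching of size 3" means that $F$ contains three pairwise vertex-disjoint pairs. An $F$-fixed realisation of $S$ is a labeled simple bipartite graph $G=(V,U,E)$ (all edges between $V$ and $U$) with $d_G(v_i)=a_i$ for all $v_i\in V$, $d_G(u_j)=b_j$ for all $u_j\in U$, $F_E\subseteq E$ and $F_N\cap E=\emptyset$. For a realisation $G$, let $A_i=\{u\in U:\{v_i,u\}\in E(G)\}$ be the adjacency list of $v_i\in V$, and let $F_i=\{u\in U:\{v_i,u\}\in F\}$ (containing both fixed neighbours and fixed non-neighbours of $v_i$). For $i\ne j$ put $A_{i-j}=A_i\setminus(F_i\cup A_j\cup F_j)$ and $A_{j-i}=A_j\setminus(F_j\cup A_i\cup F_i)$. An $F$-ignoring trade for $A_i,A_j$: choose a subset $B_{ij}$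 of $A_{i-j}\cup A_{j-i}$ of size $|A_{i-j}|$, let $B_{ji}$ be the set of remaining elements of $A_{i-j}\cup A_{j-i}$, and replace $A_{i-j}$ by $B_{ij}$ in $A_i$ and $A_{j-i}$ by $B_{ji}$ in $A_j$. $F$-ignoring Curveball algorithm: start with an $F$-fixed realisation and repeat $t$ times independently: (a) choose two distinct adjacency lists $A_i,A_j$ uniformly at random; (b) choose an $F$-ignoring trade for $A_i,A_j$ uniformly at random (i.e. $B_{ij}$ uniformly among the subsets of $A_{i-j}\cup A_{j-i}$ of size $|A_{i-j}|$) and apply it. If no nontrivial trade exists, stay in the current realisation. $F$-ignoring swap algorithm: the same, but in step (b) $B_{ij}$ is chosen uniformly among those subsets of $A_{i-j}\cup A_{j-i}$ of size $|A_{i-j}|$ that differ from $A_{i-j}$ in at most one element (i.e. $|B_{ij}\setminus A_{i-j}|\le 1$), so that at most one pair of elements is exchanged, including the possibility of staying. If $n=1$ the algorithms stay in the current realisation. *)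

theory Defs
  imports "HOL-Probability.Probability"
begin

text \<open>
  The vertices \<open>v\<^sub>1, \<dots>, v\<^sub>n\<close> and \<open>u\<^sub>1, \<dots>, u\<^sub>m\<close> are represented by their indices, and the
  unordered pair \<open>{v\<^sub>i, u\<^sub>j}\<close> by \<open>(i, j)\<close>; the two sides are told apart by the position in
  the pair. So a set of vertex pairs is a relation, \<open>E `` {i}\<close> is the adjacency
  list \<open>A\<^sub>i\<close> of \<open>v\<^sub>i\<close>, and \<open>F `` {i}\<close> is \<open>F\<^sub>i\<close>.
\<close>

type_synonym pairs = "(nat \<times> nat) set"

definition vertex_pairs :: "nat \<Rightarrow> nat \<Rightarrow> pairs" where
  "vertex_pairs n m = {1..n} \<times> {1..m}"

definition has_matching_of_size :: "pairs \<Rightarrow> nat \<Rightarrow> bool" where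
  "has_matching_of_size F k \<longleftrightarrow>
     (\<exists>M \<subseteq> F. finite M \<and> card M = k \<and>
        (\<forall>e\<in>M. \<forall>f\<in>M. e \<noteq> f \<longrightarrow> fst e \<noteq> fst f \<and> snd e \<noteq> snd f))"

definition fixed_realisations ::
  "nat \<Rightarrow> nat \<Rightarrow> (nat \<Rightarrow> nat) \<Rightarrow> (nat \<Rightarrow> nat) \<Rightarrow> pairs \<Rightarrow> pairs \<Rightarrow> pairs set" where
  "fixed_realisations n m a b F\<^sub>E F\<^sub>N =
     {E. E \<subseteq> vertex_pairs n m \<and>
         (\<forall>i\<in>{1..n}. card (E `` {i}) = a i) \<and>
         (\<forall>j\<in>{1..m}. card (E\<inverse> `` {j}) = b j) \<and>
         F\<^sub>E \<subseteq> E \<and> F\<^sub>N \<inter> E = {}}"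

definition adj_diff :: "pairs \<Rightarrow> pairs \<Rightarrow> nat \<Rightarrow> nat \<Rightarrow> nat set" where
  "adj_diff F E i j = E `` {i} - (F `` {i} \<union> E `` {j} \<union> F `` {j})"

definition curveball_choices :: "pairs \<Rightarrow> pairs \<Rightarrow> nat \<Rightarrow> nat \<Rightarrow> nat set set" where
  "curveball_choices F E i j =
     {B. B \<subseteq> adj_diff F E i j \<union> adj_diff F E j i \<and> card B = card (adj_diff F E i j)}"

definition swap_choices :: "pairs \<Rightarrow> pairs \<Rightarrow> nat \<Rightarrow> nat \<Rightarrow> nat set set" where
  "swap_choices F E i j =
     {B \<in> curveball_choices F E i j. card (B - adj_diff F E i j) \<le> 1}"

definition apply_trade :: "pairs \<Rightarrow> pairs \<Rightarrow> nat \<Rightarrow> nat \<Rightarrow> nat set \<Rightarrow> pairs" where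
  "apply_trade F E i j B =
     (let D\<^sub>i = adj_diff F E i j; D\<^sub>j = adj_diff F E j i;
          A\<^sub>i = (E `` {i} - D\<^sub>i) \<union> B;
          A\<^sub>j = (E `` {j} - D\<^sub>j) \<union> ((D\<^sub>i \<union> D\<^sub>j) - B)
      in {(k, u). u \<in> (if k = i then A\<^sub>i else if k = j then A\<^sub>j else E `` {k})})"

text \<open>
  One step of the chain, for a given rule \<open>choices\<close> producing the admissible sets \<open>B\<^sub>i\<^sub>j\<close>.
  If \<open>v\<^sub>i, v\<^sub>j\<close> admit no nontrivial trade, the only admissible set is \<open>adj_diff F E i j\<close>
  and the step stays at \<open>E\<close>.
\<close>

definition trade_step ::
  "(pairs \<Rightarrow> pairs \<Rightarrow> nat \<Rightarrow> nat \<Rightarrow> nat set set) \<Rightarrow> nat \<Rightarrow> pairs \<Rightarrow> pairs \<Rightarrow> pairs pmf" where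
  "trade_step choices n F E =
     (if n \<le> 1 then return_pmf E
      else bind_pmf (pmf_of_set {(i, j). i \<in> {1..n} \<and> j \<in> {1..n} \<and> i \<noteq> j})
             (\<lambda>(i, j). map_pmf (apply_trade F E i j) (pmf_of_set (choices F E i j))))"

primrec run_chain :: "('s \<Rightarrow> 's pmf) \<Rightarrow> nat \<Rightarrow> 's \<Rightarrow> 's pmf" where
  "run_chain step 0 x = return_pmf x"
| "run_chain step (Suc t) x = bind_pmf (run_chain step t x) step"

definition curveball_algorithm :: "nat \<Rightarrow> pairs \<Rightarrow> nat \<Rightarrow> pairs \<Rightarrow> pairs pmf" where
  "curveball_algorithm n F = run_chain (trade_step curveball_choices n F)"

definition swap_algorithm :: "nat \<Rightarrow> pairs \<Rightarrow> nat \<Rightarrow> pairs \<Rightarrow> pairs pmf" where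
  "swap_algorithm n F = run_chain (trade_step swap_choices n F)"

text \<open>
  Used only for finite nonempty \<open>R\<close>; all the distributions have finite support, so
  pointwise convergence of the mass functions is convergence in distribution (and in total
  variation).
\<close>

definition converges_to_uniform :: "(nat \<Rightarrow> 's pmf) \<Rightarrow> 's set \<Rightarrow> bool" where
  "converges_to_uniform p R \<longleftrightarrow>
     (\<forall>x. (\<lambda>t. pmf (p t) x) \<longlonglongrightarrow> pmf (pmf_of_set R) x)"

end

theory Submission
  imports Defs
begin

text \<open>
  Both chains are symmetric and lazy on the finite set of realisations. If such a chain is
  irreducible, then all entries of some power of its transition matrix are positive, and
  multiplication by this power contracts the \<open>L\<^sup>1\<close> distance to the uniform distribution. So
  everything rests on irreducibility. Let \<open>E\<close>, \<open>E'\<close> be distinct realisations, and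
  join \<open>v\<close> to \<open>v'\<close> if some \<open>u\<close> has
  \<open>(v, u) \<in> E - E'\<close> and \<open>(v', u) \<in> E' - E\<close>. Equality of degrees gives a closed walk; take a shortest
  one, \<open>v\<^sub>1, u\<^sub>1, v\<^sub>2, u\<^sub>2, \<dots>\<close>. Some chord \<open>(v\<^sub>i, u\<^sub>i\<^sub>+\<^sub>1)\<close> is not in \<open>F\<close>: for two steps it lies in
  \<open>E' - E\<close>, and for at least three steps the chords with \<open>i = 1, 2, 3\<close> form a matching. This
  chord is not in \<open>E - E'\<close>, as it would shorten the walk; hence it is missing from \<open>E\<close> or present
  in \<open>E'\<close>, and a swap on \<open>v\<^sub>i, v\<^sub>i\<^sub>+\<^sub>1, u\<^sub>i, u\<^sub>i\<^sub>+\<^sub>1\<close> applied to \<open>E\<close>, respectively \<open>E'\<close>, brings the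
  two realisations closer.
\<close>

subsection \<open>Symmetric Markov chains on a finite set\<close>

lemma run_chain_add: "run_chain K (s + t) x = bind_pmf (run_chain K s x) (run_chain K t)"
proof (induction t)
  case 0
  show ?case by (simp add: bind_return_pmf')
next
  case (Suc t)
  then show ?case by (simp add: bind_assoc_pmf)
qed

lemma pmf_bind_finite_support:
  assumes "finite S" "set_pmf p \<subseteq> S"
  shows "pmf (bind_pmf p K) y = (\<Sum>x\<in>S. pmf p x * pmf (K x) y)"
  using assms by (subst pmf_bind, subst integral_measure_pmf[OF assms(1)]) auto

text \<open>\<open>loop\<close> takes the place of aperiodicity. The relation in
  \<open>irreducible\<close> constrains only its sources, since \<open>closed\<close> keeps the
  targets in \<open>S\<close>.\<close>

locale symmetric_chain =
  fixes S :: "'s set" and K :: "'s \<Rightarrow> 's pmf"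
  assumes finite: "finite S"
    and closed: "x \<in> S \<Longrightarrow> set_pmf (K x) \<subseteq> S"
    and symmetric: "x \<in> S \<Longrightarrow> y \<in> S \<Longrightarrow> pmf (K x) y = pmf (K y) x"
    and loop: "x \<in> S \<Longrightarrow> x \<in> set_pmf (K x)"
    and irreducible: "x \<in> S \<Longrightarrow> y \<in> S \<Longrightarrow> (x, y) \<in> {(x, y). x \<in> S \<and> y \<in> set_pmf (K x)}\<^sup>*"
begin

lemma run_closed: "x \<in> S \<Longrightarrow> set_pmf (run_chain K t x) \<subseteq> S"
  by (induction t) (use closed in auto)

lemma pmf_run_add:
  assumes "x \<in> S"
  shows "pmf (run_chain K (s + t) x) y
    = (\<Sum>z\<in>S. pmf (run_chain K s x) z * pmf (run_chain K t z) y)"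
  unfolding run_chain_add by (rule pmf_bind_finite_support[OF finite run_closed[OF assms]])

lemma sum_pmf_run: "x \<in> S \<Longrightarrow> (\<Sum>y\<in>S. pmf (run_chain K t x) y) = 1"
  using sum_pmf_eq_1[OF finite run_closed] .

text \<open>A power of a symmetric matrix is symmetric: the last step from \<open>x\<close> becomes
  the first step from \<open>y\<close>, hence the two splittings \<open>t + 1\<close> and
  \<open>1 + t\<close>.\<close>

lemma run_symmetric:
  "x \<in> S \<Longrightarrow> y \<in> S \<Longrightarrow> pmf (run_chain K t x) y = pmf (run_chain K t y) x"
proof (induction t arbitrary: x y)
  case 0
  show ?case by (simp add: indicator_def)
next
  case (Suc t)
  have one: "pmf (run_chain K 1 u) v = pmf (K u) v" for u v
    by (simp add: bind_return_pmf)
  have "pmf (run_chain K (t + 1) x) y = (\<Sum>z\<in>S. pmf (run_chain K t x) z * pmf (K z) y)"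
    unfolding pmf_run_add[OF Suc.prems(1)] one ..
  also have "\<dots> = (\<Sum>z\<in>S. pmf (K y) z * pmf (run_chain K t z) x)"
    using Suc symmetric by (intro sum.cong) auto
  also have "\<dots> = pmf (run_chain K (1 + t) y) x"
    unfolding pmf_run_add[OF Suc.prems(2)] one ..
  finally show ?case by simp
qed

text \<open>By \<open>loop\<close>, a state once reached is kept with positive probability.\<close>

lemma run_mono:
  assumes "x \<in> S" "y \<in> set_pmf (run_chain K s x)" "s \<le> t"
  shows "y \<in> set_pmf (run_chain K t x)"
  using assms(3)
proof (induction t rule: dec_induct)
  case base
  then show ?case using assms by simp
next
  case (step t)
  then show ?case using loop run_closed[OF assms(1), of t] by auto
qed

text \<open>Irreducibility gives an arrival time for each pair of states; by \<open>run_mono\<close>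
  the largest of these finitely many times serves all pairs.\<close>

lemma eventually_positive:
  obtains T where "\<And>x y. x \<in> S \<Longrightarrow> y \<in> S \<Longrightarrow> y \<in> set_pmf (run_chain K T x)"
proof -
  have "\<exists>t. y \<in> set_pmf (run_chain K t x)" if "x \<in> S" "y \<in> S" for x y
    using irreducible[OF that]
  proof (induction rule: rtrancl_induct)
    case base
    then show ?case by (intro exI[of _ 0]) simp
  next
    case (step y z)
    then obtain t where "y \<in> set_pmf (run_chain K t x)" by blast
    with step(2) have "z \<in> set_pmf (run_chain K (Suc t) x)" by auto
    then show ?case by blast
  qed
  then obtain \<tau> where \<tau>: "\<And>x y. x \<in> S \<Longrightarrow> y \<in> S \<Longrightarrow> y \<in> set_pmf (run_chain K (\<tau> x y) x)"
    by metis
  define T where "T = Max (case_prod \<tau> ` (S \<times> S))"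
  have "\<tau> x y \<le> T" if "x \<in> S" "y \<in> S" for x y
    unfolding T_def using that finite by (intro Max_ge) auto
  then show thesis using \<tau> run_mono that by meson
qed

lemma run_converges:
  assumes "x \<in> S"
  shows "converges_to_uniform (\<lambda>t. run_chain K t x) S"
proof -
  have ne: "S \<noteq> {}" using assms by auto
  define N where "N = real (card S)"
  have N: "N > 0" unfolding N_def using ne finite by (simp add: card_gt_0_iff)
  define f where "f t y = pmf (run_chain K t x) y - 1 / N" for t y
  define D where "D t = (\<Sum>y\<in>S. \<bar>f t y\<bar>)" for t
  have f_sum: "(\<Sum>y\<in>S. f t y) = 0" for t
    using N by (simp add: f_def sum_subtractf sum_pmf_run[OF assms] N_def)
  \<comment> \<open>Symmetry turns columns into rows, so the uniform distribution is
    stationary.\<close>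
  have col: "(\<Sum>z\<in>S. pmf (run_chain K s z) y) = 1" if "y \<in> S" for s y
  proof -
    have "(\<Sum>z\<in>S. pmf (run_chain K s z) y) = (\<Sum>z\<in>S. pmf (run_chain K s y) z)"
      using run_symmetric that by (intro sum.cong) auto
    then show ?thesis using sum_pmf_run[OF that] by simp
  qed
  \<comment> \<open>As \<open>f t\<close> sums to zero, any constant \<open>c\<close> may be
    subtracted from all matrix entries.\<close>
  have f_add: "f (t + s) y = (\<Sum>z\<in>S. f t z * (pmf (run_chain K s z) y - c))"
    if "y \<in> S" for t s y c
  proof -
    have "(\<Sum>z\<in>S. f t z * (pmf (run_chain K s z) y - c))
        = (\<Sum>z\<in>S. f t z * pmf (run_chain K s z) y) - (\<Sum>z\<in>S. f t z) * c"
      by (simp add: right_diff_distrib sum_subtractf sum_distrib_right)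
    also have "\<dots> = (\<Sum>z\<in>S. f t z * pmf (run_chain K s z) y)"
      by (simp add: f_sum)
    also have "\<dots> = pmf (run_chain K (t + s) x) y - (\<Sum>z\<in>S. pmf (run_chain K s z) y) / N"
      by (simp add: pmf_run_add[OF assms] f_def left_diff_distrib sum_subtractf
          sum_divide_distrib)
    finally show ?thesis using col[OF that] by (simp add: f_def)
  qed
  \<comment> \<open>If \<open>c\<close> bounds all entries from below, the reduced entries are
    nonnegative and each row of them sums to \<open>1 - N * c\<close>, the contraction
    factor.\<close>
  have D_add: "D (t + s) \<le> (1 - N * c) * D t"
    if c: "\<And>y z. y \<in> S \<Longrightarrow> z \<in> S \<Longrightarrow> c \<le> pmf (run_chain K s z) y" for t s c
  proof -
    have "D (t + s) \<le> (\<Sum>y\<in>S. \<Sum>z\<in>S. \<bar>f t z\<bar> * (pmf (run_chain K s z) y - c))"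
      unfolding D_def
    proof (rule sum_mono)
      fix y assume y: "y \<in> S"
      have "\<bar>f (t + s) y\<bar> \<le> (\<Sum>z\<in>S. \<bar>f t z * (pmf (run_chain K s z) y - c)\<bar>)"
        unfolding f_add[OF y, of t s c] by (rule sum_abs)
      also have "\<dots> = (\<Sum>z\<in>S. \<bar>f t z\<bar> * (pmf (run_chain K s z) y - c))"
        using c[OF y] by (intro sum.cong) (auto simp: abs_mult)
      finally show "\<bar>f (t + s) y\<bar> \<le> (\<Sum>z\<in>S. \<bar>f t z\<bar> * (pmf (run_chain K s z) y - c))" .
    qed
    also have "\<dots> = (\<Sum>z\<in>S. \<bar>f t z\<bar> * (\<Sum>y\<in>S. pmf (run_chain K s z) y - c))"
      by (subst sum.swap) (simp add: sum_distrib_left)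
    also have "\<dots> = (\<Sum>z\<in>S. \<bar>f t z\<bar> * (1 - N * c))"
      using sum_pmf_run by (intro sum.cong) (auto simp: sum_subtractf N_def)
    also have "\<dots> = (1 - N * c) * D t"
      by (simp add: D_def sum_distrib_left mult.commute)
    finally show ?thesis .
  qed
  obtain T where T: "\<And>x y. x \<in> S \<Longrightarrow> y \<in> S \<Longrightarrow> y \<in> set_pmf (run_chain K T x)"
    using eventually_positive by blast
  define \<delta> where "\<delta> = Min ((\<lambda>(z, y). pmf (run_chain K T z) y) ` (S \<times> S))"
  have \<delta>_le: "\<delta> \<le> pmf (run_chain K T z) y" if "y \<in> S" "z \<in> S" for y z
    unfolding \<delta>_def using that finite by (intro Min_le) auto
  have "\<delta> > 0"
    unfolding \<delta>_def using T finite ne by (subst Min_gr_iff) (auto simp: pmf_positive)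
  \<comment> \<open>A row has \<open>N\<close> entries, each at least \<delta>, and sums to 1; this
    puts the contraction factor between 0 and 1.\<close>
  have "N * \<delta> \<le> (\<Sum>y\<in>S. pmf (run_chain K T x) y)"
    unfolding N_def using \<delta>_le assms by (intro sum_bounded_below) auto
  then have r: "0 \<le> 1 - N * \<delta>" "1 - N * \<delta> < 1"
    using N \<open>\<delta> > 0\<close> sum_pmf_run[OF assms] by auto
  have D_pow: "D (k * T) \<le> (1 - N * \<delta>) ^ k * D 0" for k
  proof (induction k)
    case (Suc k)
    have "D (Suc k * T) \<le> (1 - N * \<delta>) * D (k * T)"
      using D_add[of \<delta> T "k * T"] \<delta>_le by (simp add: add.commute)
    also have "\<dots> \<le> (1 - N * \<delta>) * ((1 - N * \<delta>) ^ k * D 0)"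
      using Suc r by (intro mult_left_mono) auto
    finally show ?case by (simp add: mult.assoc)
  qed simp
  \<comment> \<open>With \<open>c = 0\<close>, the distance never grows; this covers the times
    between multiples of \<open>T\<close>.\<close>
  have D_antimono: "D (t + s) \<le> D t" for t s
    using D_add[of 0 s t] by simp
  have D_nonneg: "D t \<ge> 0" for t
    unfolding D_def by (simp add: sum_nonneg)
  have "D \<longlonglongrightarrow> 0"
  proof (rule LIMSEQ_I)
    fix e :: real assume "e > 0"
    have "(\<lambda>k. (1 - N * \<delta>) ^ k * D 0) \<longlonglongrightarrow> 0"
      using r by (intro tendsto_mult_left_zero LIMSEQ_power_zero) auto
    from LIMSEQ_D[OF this \<open>e > 0\<close>] obtain k where k: "\<bar>(1 - N * \<delta>) ^ k * D 0\<bar> < e"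
      by auto
    have "D t < e" if "t \<ge> k * T" for t
      using D_antimono[of "k * T" "t - k * T"] D_pow[of k] k that by auto
    then show "\<exists>t0. \<forall>t\<ge>t0. norm (D t - 0) < e"
      using D_nonneg by (intro exI[of _ "k * T"]) auto
  qed
  have "(\<lambda>t. pmf (run_chain K t x) y) \<longlonglongrightarrow> pmf (pmf_of_set S) y" for y
  proof (cases "y \<in> S")
    case True
    have "\<bar>f t y\<bar> \<le> D t" for t
      unfolding D_def using finite True by (intro member_le_sum) auto
    then have "(\<lambda>t. f t y) \<longlonglongrightarrow> 0"
      by (intro Lim_null_comparison[OF _ \<open>D \<longlonglongrightarrow> 0\<close>]) auto
    then have "(\<lambda>t. pmf (run_chain K t x) y) \<longlonglongrightarrow> 1 / N"
      unfolding f_def by (rule LIM_zero_cancel)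
    then show ?thesis using True finite ne by (simp add: N_def)
  next
    case False
    then have "pmf (run_chain K t x) y = 0" for t
      using run_closed[OF assms, of t] by (subst pmf_eq_0_set_pmf) auto
    then show ?thesis using False finite ne by simp
  qed
  then show ?thesis unfolding converges_to_uniform_def by blast
qed

end

subsection \<open>Trades\<close>

lemma in_adj_diff_iff:
  "u \<in> adj_diff F E i j \<longleftrightarrow>
     (i, u) \<in> E \<and> (j, u) \<notin> E \<and> (i, u) \<notin> F \<and> (j, u) \<notin> F"
  unfolding adj_diff_def by auto

lemma adj_diff_disjoint: "adj_diff F E i j \<inter> adj_diff F E j i = {}"
  by (auto simp: in_adj_diff_iff)

text \<open>The pool that a trade redistributes. A trade changes only its split into the two
  \<open>adj_diff\<close> sets, not the pool itself.\<close>

definition tradeable :: "pairs \<Rightarrow> pairs \<Rightarrow> nat \<Rightarrow> nat \<Rightarrow> nat set" where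
  "tradeable F E i j = adj_diff F E i j \<union> adj_diff F E j i"

lemma in_tradeable_iff:
  "u \<in> tradeable F E i j \<longleftrightarrow>
     ((i, u) \<in> E \<longleftrightarrow> (j, u) \<notin> E) \<and> (i, u) \<notin> F \<and> (j, u) \<notin> F"
  unfolding tradeable_def by (auto simp: in_adj_diff_iff)

lemma in_apply_trade_iff:
  assumes "i \<noteq> j" "B \<subseteq> tradeable F E i j"
  shows "(k, u) \<in> apply_trade F E i j B \<longleftrightarrow>
    (if k = i \<and> u \<in> tradeable F E i j then u \<in> B
     else if k = j \<and> u \<in> tradeable F E i j then u \<notin> B
     else (k, u) \<in> E)"
proof (cases "u \<in> tradeable F E i j")
  case True
  then show ?thesis
    using assms(1) by (auto simp: apply_trade_def Let_def tradeable_def in_adj_diff_iff)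
next
  case False
  then have "u \<notin> B" using assms(2) by blast
  with False show ?thesis
    using assms(1) by (simp add: apply_trade_def Let_def tradeable_def)
qed

text \<open>Lets \<open>B\<close> be read off the result, which underlies both the injectivity and
  the reversal of trades.\<close>

lemma adj_diff_apply_trade:
  assumes "i \<noteq> j" "B \<subseteq> tradeable F E i j"
  shows "adj_diff F (apply_trade F E i j B) i j = B"
    and "adj_diff F (apply_trade F E i j B) j i = tradeable F E i j - B"
proof -
  have "u \<in> adj_diff F (apply_trade F E i j B) i j \<longleftrightarrow> u \<in> B"
    and "u \<in> adj_diff F (apply_trade F E i j B) j i \<longleftrightarrow> u \<in> tradeable F E i j - B" for u
    using assms(1) subsetD[OF assms(2), of u]
    by (auto simp: in_adj_diff_iff in_apply_trade_iff[OF assms] in_tradeable_iff split: if_splits)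
  then show "adj_diff F (apply_trade F E i j B) i j = B"
    and "adj_diff F (apply_trade F E i j B) j i = tradeable F E i j - B" by blast+
qed

lemma tradeable_apply_trade:
  assumes "i \<noteq> j" "B \<subseteq> tradeable F E i j"
  shows "tradeable F (apply_trade F E i j B) i j = tradeable F E i j"
  using assms(2) unfolding tradeable_def[of F "apply_trade F E i j B"]
    adj_diff_apply_trade[OF assms] by blast

lemma apply_trade_inverse:
  assumes "i \<noteq> j" "B \<subseteq> tradeable F E i j"
  shows "apply_trade F (apply_trade F E i j B) i j (adj_diff F E i j) = E"
proof -
  have sub: "adj_diff F E i j \<subseteq> tradeable F (apply_trade F E i j B) i j"
    unfolding tradeable_apply_trade[OF assms] by (auto simp: tradeable_def)
  have "(k, u) \<in> apply_trade F (apply_trade F E i j B) i j (adj_diff F E i j) \<longleftrightarrow> (k, u) \<in> E"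
    for k u
    by (cases "u \<in> tradeable F E i j")
      (simp_all only: in_apply_trade_iff[OF assms(1) sub] tradeable_apply_trade[OF assms]
        in_apply_trade_iff[OF assms] in_adj_diff_iff simp_thms if_True if_False,
        auto simp: in_tradeable_iff)
  then show ?thesis by auto
qed

lemma apply_trade_adj_diff:
  assumes "i \<noteq> j"
  shows "apply_trade F E i j (adj_diff F E i j) = E"
proof -
  have sub: "adj_diff F E i j \<subseteq> tradeable F E i j"
    by (auto simp: tradeable_def)
  have "(k, u) \<in> apply_trade F E i j (adj_diff F E i j) \<longleftrightarrow> (k, u) \<in> E" for k u
    by (cases "u \<in> tradeable F E i j")
      (simp_all only: in_apply_trade_iff[OF assms(1) sub] in_adj_diff_iff simp_thms
        if_True if_False, auto simp: in_tradeable_iff)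
  then show ?thesis by auto
qed

text \<open>
  Covers both rules at once: \<open>Q\<close> restricts how many elements are exchanged.
\<close>

definition bounded_choices ::
  "(nat \<Rightarrow> bool) \<Rightarrow> pairs \<Rightarrow> pairs \<Rightarrow> nat \<Rightarrow> nat \<Rightarrow> nat set set" where
  "bounded_choices Q F E i j = {B \<in> curveball_choices F E i j. Q (card (B - adj_diff F E i j))}"

lemma curveball_choices_eq: "curveball_choices = bounded_choices (\<lambda>_. True)"
  by (intro ext) (simp add: bounded_choices_def)

lemma swap_choices_eq: "swap_choices = bounded_choices (\<lambda>c. c \<le> 1)"
  by (intro ext) (simp add: bounded_choices_def swap_choices_def)

section \<open>Counting admissible choices and symmetry of a single trade\<close>

lemma in_bounded_choices_iff:
  "B \<in> bounded_choices Q F E i j \<longleftrightarrow>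
     B \<subseteq> tradeable F E i j \<and> card B = card (adj_diff F E i j) \<and> Q (card (B - adj_diff F E i j))"
  by (auto simp: bounded_choices_def curveball_choices_def tradeable_def)

text \<open>A permutation of \<open>U\<close> mapping \<open>D\<close> onto \<open>D'\<close>
  carries the sets counted on the left to those on the right, as it preserves all cardinalities
  involved. It is glued from bijections on \<open>D\<close> and on its complement.\<close>

lemma card_subsets_near:
  assumes "finite U" "D \<subseteq> U" "D' \<subseteq> U" "card D = card D'"
  shows "card {B. B \<subseteq> U \<and> card B = card D \<and> Q (card (B - D))}
    = card {B. B \<subseteq> U \<and> card B = card D' \<and> Q (card (B - D'))}"
proof -
  have fin: "finite D" "finite D'"
    using assms finite_subset by blast+
  obtain g where g: "bij_betw g D D'"
    using finite_same_card_bij[OF fin assms(4)] by blast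
  have "card (U - D) = card (U - D')"
    using assms fin by (simp add: card_Diff_subset)
  then obtain h where h: "bij_betw h (U - D) (U - D')"
    using finite_same_card_bij[of "U - D" "U - D'"] assms(1) by blast
  define f where "f x = (if x \<in> D then g x else h x)" for x
  have fD: "bij_betw f D D'"
    using g by (rule bij_betw_cong[THEN iffD1, rotated]) (auto simp: f_def)
  have fU: "bij_betw f (U - D) (U - D')"
    using h by (rule bij_betw_cong[THEN iffD1, rotated]) (auto simp: f_def)
  have f: "bij_betw f U U"
    using bij_betw_combine[OF fD fU] assms(2,3) by (simp add: Un_absorb1)
  have card_f: "card (f ` B) = card B" if "B \<subseteq> U" for B
    using f that by (meson bij_betw_def card_image inj_on_subset)
  have diff: "f ` B - D' = f ` (B - D)" if "B \<subseteq> U" for B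
    using inj_on_image_set_diff[of f U B D] that assms(2) bij_betw_imp_inj_on[OF f]
      bij_betw_imp_surj_on[OF fD] by auto
  have cards: "card (f ` B) = card B" "card (f ` B - D') = card (B - D)" if "B \<subseteq> U" for B
    using that card_f[of B] card_f[of "B - D"] diff[of B] by auto
  have "bij_betw ((`) f) {B. B \<subseteq> U \<and> card B = card D \<and> Q (card (B - D))}
     {B. B \<subseteq> U \<and> card B = card D' \<and> Q (card (B - D'))}"
  proof (rule bij_betw_imageI)
    show "inj_on ((`) f) {B. B \<subseteq> U \<and> card B = card D \<and> Q (card (B - D))}"
      by (rule inj_on_subset[OF inj_on_image_Pow[OF bij_betw_imp_inj_on[OF f]]]) auto
    show "(`) f ` {B. B \<subseteq> U \<and> card B = card D \<and> Q (card (B - D))} =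
      {B. B \<subseteq> U \<and> card B = card D' \<and> Q (card (B - D'))}"
    proof (intro equalityI subsetI)
      fix C assume C: "C \<in> {B. B \<subseteq> U \<and> card B = card D' \<and> Q (card (B - D'))}"
      then obtain B where "B \<subseteq> U" "C = f ` B"
        using f by (metis (no_types, lifting) bij_betw_def mem_Collect_eq subset_imageE)
      then show "C \<in> (`) f ` {B. B \<subseteq> U \<and> card B = card D \<and> Q (card (B - D))}"
        using C assms(4) by (auto simp: cards intro!: imageI)
    qed (use assms(4) f in \<open>auto simp: cards bij_betw_def\<close>)
  qed
  then show ?thesis by (rule bij_betw_same_card)
qed

text \<open>The pool stays and the reference set \<open>adj_diff F E i j\<close> becomes
  \<open>B\<close>, of equal size. So a trade and its reversal are chosen with equal
  probability.\<close>

lemma card_bounded_choices_apply_trade: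
  assumes "i \<noteq> j" "finite (tradeable F E i j)" "B \<in> bounded_choices Q F E i j"
  shows "card (bounded_choices Q F (apply_trade F E i j B) i j) = card (bounded_choices Q F E i j)"
proof -
  have B: "B \<subseteq> tradeable F E i j" "card B = card (adj_diff F E i j)"
    using assms(3) by (auto simp: in_bounded_choices_iff)
  have "bounded_choices Q F (apply_trade F E i j B) i j
    = {C. C \<subseteq> tradeable F E i j \<and> card C = card B \<and> Q (card (C - B))}"
    by (auto simp: in_bounded_choices_iff tradeable_apply_trade[OF assms(1) B(1)]
        adj_diff_apply_trade[OF assms(1) B(1)])
  moreover have "bounded_choices Q F E i j
    = {C. C \<subseteq> tradeable F E i j \<and> card C = card (adj_diff F E i j)
         \<and> Q (card (C - adj_diff F E i j))}"
    by (auto simp: in_bounded_choices_iff)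
  ultimately show ?thesis
    using card_subsets_near[OF assms(2) B(1) _ B(2)] by (simp add: tradeable_def)
qed

text \<open>For finite sets of equal size the two set differences have equal size, so
  \<open>Q\<close> also admits the reverse trade.\<close>

lemma adj_diff_in_bounded_choices_apply_trade:
  assumes "i \<noteq> j" "finite (tradeable F E i j)" "B \<in> bounded_choices Q F E i j"
  shows "adj_diff F E i j \<in> bounded_choices Q F (apply_trade F E i j B) i j"
proof -
  have B: "B \<subseteq> tradeable F E i j" "card B = card (adj_diff F E i j)"
      "Q (card (B - adj_diff F E i j))"
    using assms(3) by (auto simp: in_bounded_choices_iff)
  have fin: "finite B" "finite (adj_diff F E i j)"
    using B(1) assms(2) finite_subset by (auto simp: tradeable_def)
  have "card (adj_diff F E i j - B) = card (B - adj_diff F E i j)"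
    using B(2) fin by (simp add: card_Diff_subset_Int Int_commute)
  then show ?thesis
    using B by (auto simp: in_bounded_choices_iff tradeable_apply_trade[OF assms(1) B(1)]
        adj_diff_apply_trade[OF assms(1) B(1)] tradeable_def)
qed

text \<open>Distinct choices give distinct results, since \<open>adj_diff\<close> recovers
  \<open>B\<close>; so the result is uniform on the image. \<open>Q 0\<close> admits the trivial
  trade and keeps the set of choices nonempty, as \<open>pmf_of_set\<close> requires.\<close>

lemma pmf_map_trade_eq:
  assumes "i \<noteq> j" "finite (tradeable F E i j)" "Q 0"
  shows "pmf (map_pmf (apply_trade F E i j) (pmf_of_set (bounded_choices Q F E i j))) E' =
    (if E' \<in> apply_trade F E i j ` bounded_choices Q F E i j
     then 1 / card (bounded_choices Q F E i j) else 0)"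
proof -
  let ?C = "bounded_choices Q F E i j"
  have fin: "finite ?C"
    by (rule finite_subset[of _ "Pow (tradeable F E i j)"])
      (use assms(2) in \<open>auto simp: in_bounded_choices_iff\<close>)
  have "adj_diff F E i j \<in> ?C"
    using assms(3) by (simp add: in_bounded_choices_iff tradeable_def)
  then have ne: "?C \<noteq> {}" by auto
  have "inj_on (apply_trade F E i j) ?C"
    by (rule inj_on_inverseI[of _ "\<lambda>E'. adj_diff F E' i j"])
      (use assms(1) in \<open>auto simp: in_bounded_choices_iff intro!: adj_diff_apply_trade(1)\<close>)
  then show ?thesis
    using fin ne by (simp add: map_pmf_of_set_inj card_image indicator_def)
qed

lemma pmf_map_trade_symmetric:
  assumes "i \<noteq> j" "finite (tradeable F E i j)" "finite (tradeable F E' i j)" "Q 0"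
  shows "pmf (map_pmf (apply_trade F E i j) (pmf_of_set (bounded_choices Q F E i j))) E'
    = pmf (map_pmf (apply_trade F E' i j) (pmf_of_set (bounded_choices Q F E' i j))) E"
proof -
  \<comment> \<open>Stated for arbitrary \<open>E\<close>, \<open>E'\<close>, so that it serves in
    both directions below.\<close>
  have *: "E \<in> apply_trade F E' i j ` bounded_choices Q F E' i j \<and>
      card (bounded_choices Q F E' i j) = card (bounded_choices Q F E i j)"
    if E': "E' \<in> apply_trade F E i j ` bounded_choices Q F E i j"
      and fin: "finite (tradeable F E i j)" for E E'
  proof -
    obtain B where B: "B \<in> bounded_choices Q F E i j" and E': "E' = apply_trade F E i j B"
      using E' by blast
    have sub: "B \<subseteq> tradeable F E i j"
      using B by (simp add: in_bounded_choices_iff)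
    have "E = apply_trade F E' i j (adj_diff F E i j)"
      unfolding E' by (rule apply_trade_inverse[OF assms(1) sub, symmetric])
    moreover have "adj_diff F E i j \<in> bounded_choices Q F E' i j"
      unfolding E' by (rule adj_diff_in_bounded_choices_apply_trade[OF assms(1) fin B])
    ultimately show ?thesis
      using card_bounded_choices_apply_trade[OF assms(1) fin B] E' by blast
  qed
  note pmf_eq = pmf_map_trade_eq[where Q = Q]
  show ?thesis
  proof (cases "E' \<in> apply_trade F E i j ` bounded_choices Q F E i j")
    case True
    show ?thesis
      using *[OF True assms(2)] True
      by (simp only: pmf_eq[OF assms(1,2,4)] pmf_eq[OF assms(1,3,4)] if_True)
  next
    case False
    then have "E \<notin> apply_trade F E' i j ` bounded_choices Q F E' i j"
      using *[OF _ assms(3)] by blast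
    with False show ?thesis
      by (simp only: pmf_eq[OF assms(1,2,4)] pmf_eq[OF assms(1,3,4)] if_False)
  qed
qed

section \<open>Trades preserve the set of realisations\<close>

lemma apply_trade_closed:
  assumes E: "E \<in> fixed_realisations n m a b F\<^sub>E F\<^sub>N" and ij: "i \<in> {1..n}" "j \<in> {1..n}" "i \<noteq> j"
    and F: "F = F\<^sub>E \<union> F\<^sub>N" and B: "B \<in> curveball_choices F E i j"
  shows "apply_trade F E i j B \<in> fixed_realisations n m a b F\<^sub>E F\<^sub>N"
proof -
  let ?D = "adj_diff F E i j" and ?D' = "adj_diff F E j i" and ?E = "apply_trade F E i j B"
  have sub: "B \<subseteq> tradeable F E i j" and card_B: "card B = card ?D"
    using B by (auto simp: curveball_choices_def tradeable_def)
  have B_D: "u \<in> B \<Longrightarrow> ((i, u) \<in> E \<longleftrightarrow> (j, u) \<notin> E) \<and> (i, u) \<notin> F \<and> (j, u) \<notin> F" for u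
    using subsetD[OF sub] by (simp add: in_tradeable_iff)
  note E_iff = in_apply_trade_iff[OF ij(3) sub]
  have E_sub: "E \<subseteq> vertex_pairs n m"
    and rows: "\<And>k. k \<in> {1..n} \<Longrightarrow> card (E `` {k}) = a k"
    and cols: "\<And>u. u \<in> {1..m} \<Longrightarrow> card (E\<inverse> `` {u}) = b u"
    and FE: "F\<^sub>E \<subseteq> E" and FN: "F\<^sub>N \<inter> E = {}"
    using E by (auto simp: fixed_realisations_def)
  have fin: "finite (E `` {k})" for k
    by (rule finite_subset[of _ "{1..m}"]) (use E_sub in \<open>auto simp: vertex_pairs_def\<close>)
  have finD: "finite ?D" "finite ?D'"
    using fin by (auto simp: adj_diff_def)
  then have finT: "finite (tradeable F E i j)" by (simp add: tradeable_def)
  then have finB: "finite B" using sub finite_subset by blast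
  have F_iff: "(k, u) \<in> ?E \<longleftrightarrow> (k, u) \<in> E" if "(k, u) \<in> F" for k u
  proof -
    have "\<not> (k = i \<and> u \<in> tradeable F E i j)" "\<not> (k = j \<and> u \<in> tradeable F E i j)"
      using that by (auto simp: in_tradeable_iff)
    then show ?thesis by (simp only: E_iff if_False)
  qed
  have row_i: "?E `` {i} = (E `` {i} - ?D) \<union> B"
    by (intro set_eqI) (use B_D in \<open>auto simp: E_iff in_adj_diff_iff in_tradeable_iff\<close>)
  have row_j: "?E `` {j} = (E `` {j} - ?D') \<union> (tradeable F E i j - B)"
    by (intro set_eqI) (use B_D ij(3) in \<open>auto simp: E_iff in_adj_diff_iff in_tradeable_iff\<close>)
  have row: "?E `` {k} = E `` {k}" if "k \<noteq> i" "k \<noteq> j" for k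
    using that by (auto simp: E_iff)
  have D_sub: "?D \<subseteq> E `` {i}" "?D' \<subseteq> E `` {j}"
    by (auto simp: in_adj_diff_iff)
  have "card (?E `` {i}) = card (E `` {i} - ?D) + card B"
    unfolding row_i using fin finB B_D
    by (intro card_Un_disjoint) (auto simp: in_adj_diff_iff)
  also have "\<dots> = card (E `` {i})"
    using card_B D_sub(1) finD(1) card_mono[OF fin D_sub(1)] by (simp add: card_Diff_subset)
  finally have card_i: "card (?E `` {i}) = card (E `` {i})" .
  have "card (tradeable F E i j - B) = card ?D'"
    using sub finB card_B card_Un_disjoint[OF finD adj_diff_disjoint]
    by (simp add: card_Diff_subset tradeable_def)
  moreover have "card (?E `` {j}) = card (E `` {j} - ?D') + card (tradeable F E i j - B)"
    unfolding row_j using fin finT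
    by (intro card_Un_disjoint) (auto simp: in_adj_diff_iff in_tradeable_iff)
  ultimately have card_j: "card (?E `` {j}) = card (E `` {j})"
    using D_sub(2) finD(2) card_mono[OF fin D_sub(2)] by (simp add: card_Diff_subset)
  have "card (?E `` {k}) = a k" if "k \<in> {1..n}" for k
    using rows[OF that] card_i card_j row by metis
  moreover have "card (?E\<inverse> `` {u}) = b u" if "u \<in> {1..m}" for u
  proof -
    \<comment> \<open>A tradeable \<open>u\<close> is adjacent to exactly one of \<open>i\<close>
      and \<open>j\<close>, so a trade either keeps its column or interchanges \<open>i\<close> and
      \<open>j\<close> in it.\<close>
    have "?E\<inverse> `` {u} = E\<inverse> `` {u} \<or> ?E\<inverse> `` {u} = Transposition.transpose i j ` (E\<inverse> `` {u})"
    proof (cases "u \<in> tradeable F E i j \<and> ((i, u) \<in> E \<longleftrightarrow> u \<notin> B)")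
      case True
      have "k \<in> ?E\<inverse> `` {u} \<longleftrightarrow> k \<in> Transposition.transpose i j ` (E\<inverse> `` {u})" for k
        using True ij(3)
        by (auto simp: E_iff in_tradeable_iff in_transpose_image_iff Transposition.transpose_def)
      then show ?thesis by blast
    next
      case False
      have "k \<in> ?E\<inverse> `` {u} \<longleftrightarrow> k \<in> E\<inverse> `` {u}" for k
        using False ij(3) B_D by (auto simp: E_iff in_tradeable_iff)
      then show ?thesis by blast
    qed
    then show ?thesis
      using cols[OF that] by (auto simp: card_image)
  qed
  moreover have "?E \<subseteq> vertex_pairs n m"
  proof -
    have "(k, u) \<in> vertex_pairs n m" if "(k, u) \<in> ?E" for k u
    proof (cases "(k, u) \<in> E")
      case False
      with that have k: "k = i \<or> k = j" and u: "u \<in> tradeable F E i j"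
        unfolding E_iff by metis+
      \<comment> \<open>A new pair lies in row \<open>i\<close> or \<open>j\<close>, and its column
        already carries an edge of \<open>E\<close>; so both coordinates are in range.\<close>
      from u have "(i, u) \<in> E \<or> (j, u) \<in> E"
        by (auto simp: in_tradeable_iff)
      with k show ?thesis using ij E_sub by (auto simp: vertex_pairs_def)
    qed (use E_sub in auto)
    then show ?thesis by auto
  qed
  moreover have "F\<^sub>E \<subseteq> ?E" "F\<^sub>N \<inter> ?E = {}"
    using FE FN F_iff F by auto
  ultimately show ?thesis
    by (simp add: fixed_realisations_def)
qed

subsection \<open>Alternating cycles\<close>

text \<open>Two target points are allowed because symmetry of the chain compares a move with its
  reverse, under the same random row pair.\<close>

lemma pmf_bind_pmf_cong:
  assumes "\<And>z. z \<in> set_pmf p \<Longrightarrow> pmf (f z) x = pmf (g z) y"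
  shows "pmf (bind_pmf p f) x = pmf (bind_pmf p g) y"
  unfolding pmf_bind by (intro integral_cong_AE) (auto simp: AE_measure_pmf_iff assms)

text \<open>A closed walk of least length, continued periodically so that indices need no
  wrap-around. A shortcut or a repeated vertex would give a shorter closed walk.\<close>

lemma shortest_cycle:
  fixes R :: "'v rel"
  assumes "\<not> acyclic R"
  obtains k w where "k > 0" "\<And>i. (w i, w (Suc i)) \<in> R" "\<And>i. w (i + k) = w i"
    "\<And>i s. 0 < s \<Longrightarrow> s < k \<Longrightarrow> (w i, w (i + s + 1)) \<notin> R"
    "\<And>i s. 0 < s \<Longrightarrow> s < k \<Longrightarrow> w i \<noteq> w (i + s)"
proof -
  define P where "P k \<longleftrightarrow> k > 0 \<and> (\<exists>x. (x, x) \<in> R ^^ k)" for k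
  have "\<exists>k. P k"
    using assms unfolding acyclic_def trancl_power P_def by auto
  define k where "k = (LEAST k. P k)"
  have "P k" unfolding k_def using \<open>\<exists>k. P k\<close> by (rule LeastI_ex)
  then obtain x where k: "k > 0" "(x, x) \<in> R ^^ k" by (auto simp: P_def)
  have least: "l = 0" if "l < k" "(y, y) \<in> R ^^ l" for l y
    using not_less_Least[of l P] that unfolding k_def P_def by auto
  obtain f where f: "f 0 = x" "f k = x" "\<And>i. i < k \<Longrightarrow> (f i, f (Suc i)) \<in> R"
    using k(2) unfolding relpow_fun_conv by auto
  define w where "w i = f (i mod k)" for i
  have step: "(w i, w (Suc i)) \<in> R" for i
  proof (cases "Suc (i mod k) = k")
    case True
    then show ?thesis using f(3)[of "i mod k"] k(1) f(1,2)
      by (simp add: w_def mod_Suc)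
  next
    case False
    then show ?thesis using f(3)[of "i mod k"] k(1) by (simp add: w_def mod_Suc)
  qed
  have per: "w (i + k) = w i" for i by (simp add: w_def)
  have walk: "(w i, w (i + l)) \<in> R ^^ l" for i l
    by (induction l) (use step in auto)
  have shortcut: "(w i, w (i + s + 1)) \<notin> R" if s: "0 < s" "s < k" for i s
  proof
    assume R: "(w i, w (i + s + 1)) \<in> R"
    \<comment> \<open>The shortcut replaces \<open>s + 1\<close> steps by one; the other
      \<open>k - s - 1\<close> steps lead back to \<open>w i\<close> by periodicity.\<close>
    have "(w (i + s + 1), w i) \<in> R ^^ (k - s - 1)"
      using walk[of "i + s + 1" "k - s - 1"] s per[of i] by simp
    with R have "(w i, w i) \<in> R ^^ (k - s)"
      using s relpow_Suc_I2[of "w i" "w (i + s + 1)" R "w i" "k - s - 1"]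
      by (simp add: Suc_diff_Suc)
    then show False using least[of "k - s" "w i"] s by simp
  qed
  have distinct: "w i \<noteq> w (i + s)" if s: "0 < s" "s < k" for i s
    using walk[of i s] least[of s "w i"] s by auto
  show thesis by (rule that[OF k(1) step per shortcut distinct])
qed

section \<open>Matchings and improving swaps\<close>

lemma has_matching_of_size_3I:
  assumes "(v\<^sub>1, u\<^sub>1) \<in> F" "(v\<^sub>2, u\<^sub>2) \<in> F" "(v\<^sub>3, u\<^sub>3) \<in> F"
    and "v\<^sub>1 \<noteq> v\<^sub>2" "v\<^sub>1 \<noteq> v\<^sub>3" "v\<^sub>2 \<noteq> v\<^sub>3" "u\<^sub>1 \<noteq> u\<^sub>2" "u\<^sub>1 \<noteq> u\<^sub>3" "u\<^sub>2 \<noteq> u\<^sub>3"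
  shows "has_matching_of_size F 3"
  unfolding has_matching_of_size_def
  by (rule exI[of _ "{(v\<^sub>1, u\<^sub>1), (v\<^sub>2, u\<^sub>2), (v\<^sub>3, u\<^sub>3)}"]) (use assms in auto)

text \<open>An alternating 4-cycle of \<open>E\<close> avoiding \<open>F\<close>: the swap replaces
  \<open>(v, u)\<close>, \<open>(v', u')\<close> by \<open>(v', u)\<close>,
  \<open>(v, u')\<close>.\<close>

definition swappable :: "pairs \<Rightarrow> pairs \<Rightarrow> nat \<Rightarrow> nat \<Rightarrow> nat \<Rightarrow> nat \<Rightarrow> bool" where
  "swappable F E v v' u u' \<longleftrightarrow>
     (v, u) \<in> E \<and> (v', u') \<in> E \<and> (v', u) \<notin> E \<and> (v, u') \<notin> E \<and>
     {(v, u), (v', u'), (v', u), (v, u')} \<inter> F = {}"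

lemma balanced_Diff_nonempty:
  assumes "finite A" "finite B" "card A = card B" "x \<in> A - B"
  obtains y where "y \<in> B - A"
  using assms card_subset_eq[of A B] by (metis DiffE DiffI card_subset_eq subsetI that)

text \<open>Three corners lie in the symmetric difference, so the swap repairs three pairs and can
  spoil only \<open>(v, u')\<close>. The rows are reversed for \<open>E'\<close>, whose edges on the
  4-cycle are the opposite ones.\<close>

lemma exists_improving_swap:
  assumes E: "E \<in> fixed_realisations n m a b F\<^sub>E F\<^sub>N" and E': "E' \<in> fixed_realisations n m a b F\<^sub>E F\<^sub>N"
    and "E \<noteq> E'" and F: "F = F\<^sub>E \<union> F\<^sub>N" and no_matching: "\<not> has_matching_of_size F 3"
  obtains v v' u u' where "(v, u) \<in> E - E'" "(v', u) \<in> E' - E" "(v', u') \<in> E - E'"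
    "swappable F E v v' u u' \<or> swappable F E' v' v u u'"
proof -
  define R where "R = {(v, v'). \<exists>u. (v, u) \<in> E - E' \<and> (v', u) \<in> E' - E}"
  have sub: "E \<subseteq> vertex_pairs n m" "E' \<subseteq> vertex_pairs n m"
    using E E' by (auto simp: fixed_realisations_def)
  then have fin: "finite E" "finite E'"
    by (auto intro: finite_subset simp: vertex_pairs_def)
  have fin_rows: "finite (E `` {i})" "finite (E' `` {i})"
    and fin_cols: "finite (E\<inverse> `` {i})" "finite (E'\<inverse> `` {i})" for i
    using fin by (auto intro: finite_Image)
  have row: "card (E `` {i}) = card (E' `` {i})" if "i \<in> {1..n}" for i
    using that E E' by (simp add: fixed_realisations_def)
  have col: "card (E\<inverse> `` {j}) = card (E'\<inverse> `` {j})" if "j \<in> {1..m}" for j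
    using that E E' by (simp add: fixed_realisations_def)
  \<comment> \<open>Equal column degrees let a pair of \<open>E - E'\<close> start a step of
    \<open>R\<close>; equal row degrees, in \<open>out\<close>, provide such a pair at the end of
    the step. So walks in \<open>R\<close> never get stuck.\<close>
  have succ: "\<exists>v'. (v, v') \<in> R" if "(v, u) \<in> E - E'" for v u
  proof -
    have "u \<in> {1..m}" using that sub by (auto simp: vertex_pairs_def)
    from balanced_Diff_nonempty[OF fin_cols col[OF this], of v] that
    obtain v' where "v' \<in> E'\<inverse> `` {u} - E\<inverse> `` {u}" by auto
    then show ?thesis using that unfolding R_def by auto
  qed
  have out: "\<exists>u. (v, u) \<in> E - E'" if "(v, u) \<in> E' - E" for v u
  proof -
    have "v \<in> {1..n}" using that sub by (auto simp: vertex_pairs_def)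
    from balanced_Diff_nonempty[OF fin_rows(2,1) row[OF this, symmetric], of u] that
    obtain u' where "u' \<in> E `` {v} - E' `` {v}" by auto
    then show ?thesis by auto
  qed
  have "\<not> acyclic R"
  proof
    assume "acyclic R"
    have "R \<subseteq> fst ` E \<times> fst ` E'" unfolding R_def by force
    then have "finite R" using fin finite_subset by blast
    then have wf: "wf (R\<inverse>)" using \<open>acyclic R\<close> by (rule finite_acyclic_wf_converse)
    obtain v where v: "v \<in> Domain R"
      using \<open>E \<noteq> E'\<close> succ out by (metis DiffI Domain.intros subrelI subset_antisym)
    obtain z where z: "z \<in> Domain R" "\<And>y. (y, z) \<in> R\<inverse> \<Longrightarrow> y \<notin> Domain R"
      using wfE_min[OF wf v] by blast
    then obtain y u where "(z, y) \<in> R" "(y, u) \<in> E' - E" unfolding R_def by auto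
    with z(2) out succ show False by blast
  qed
  then obtain k w where k: "k > 0" and w: "\<And>i. (w i, w (Suc i)) \<in> R" "\<And>i. w (i + k) = w i"
    and shortcut: "\<And>i s. 0 < s \<Longrightarrow> s < k \<Longrightarrow> (w i, w (i + s + 1)) \<notin> R"
    and distinct: "\<And>i s. 0 < s \<Longrightarrow> s < k \<Longrightarrow> w i \<noteq> w (i + s)"
    using shortest_cycle by metis
  obtain \<mu> where \<mu>: "\<And>i. (w i, \<mu> i) \<in> E - E'" "\<And>i. (w (Suc i), \<mu> i) \<in> E' - E"
    using w(1) unfolding R_def by (simp only: mem_Collect_eq case_prod_conv) metis
  \<comment> \<open>For \<open>k = 1\<close> the pair \<open>(w 0, \<mu> 0)\<close> would lie in
    both differences.\<close>
  have "k \<noteq> 1"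
    using w(2)[of 0] \<mu>(1)[of 0] \<mu>(2)[of 0] by auto
  with k have "k \<ge> 2" by simp
  have agree: "e \<in> E \<longleftrightarrow> e \<in> E'" if "e \<in> F" for e
    using that E E' F by (auto simp: fixed_realisations_def)
  have chord: "(w i, \<mu> (i + 1)) \<notin> E - E'" for i
  proof
    assume "(w i, \<mu> (i + 1)) \<in> E - E'"
    then have "(w i, w (i + 1 + 1)) \<in> R"
      using \<mu>(2)[of "i + 1"] unfolding R_def by auto
    then show False using shortcut[of 1 i] \<open>k \<ge> 2\<close> by simp
  qed
  have "\<exists>i. (w i, \<mu> (i + 1)) \<notin> F"
  proof (cases "k = 2")
    \<comment> \<open>Here \<open>w 2 = w 0\<close>, so the chord \<open>(w 0, \<mu> 1)\<close> lies
      in \<open>E' - E\<close>, where \<open>F\<close> has no pairs.\<close>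
    case True
    then show ?thesis using \<mu>(2)[of 1] w(2)[of 0] agree by (intro exI[of _ 0]) auto
  next
    case False
    with \<open>k \<ge> 2\<close> have k3: "k \<ge> 3" by simp
    have \<mu>_distinct: "\<mu> i \<noteq> \<mu> (i + s)" if "0 < s" "s < k" for i s
    proof
      assume "\<mu> i = \<mu> (i + s)"
      then have "(w i, w (i + s + 1)) \<in> R"
        using \<mu>(1)[of i] \<mu>(2)[of "i + s"] unfolding R_def by auto
      then show False using shortcut that by blast
    qed
    show ?thesis
    proof (rule ccontr)
      assume "\<nexists>i. (w i, \<mu> (i + 1)) \<notin> F"
      then have "(w i, \<mu> (i + 1)) \<in> F" for i by blast
      \<comment> \<open>Nothing is known about periodicity of \<open>\<mu>\<close>, but the indices
        1, 2, 3 differ by at most 2, which is less than \<open>k\<close>.\<close>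
      then have "has_matching_of_size F 3"
        using k3 distinct[of 1 0] distinct[of 1 1] distinct[of 2 0]
          \<mu>_distinct[of 1 1] \<mu>_distinct[of 1 2] \<mu>_distinct[of 2 1]
        by (intro has_matching_of_size_3I[of "w 0" "\<mu> 1" F "w 1" "\<mu> 2" "w 2" "\<mu> 3"])
          (auto simp: numeral_eq_Suc)
      then show False using no_matching by blast
    qed
  qed
  then obtain i where i: "(w i, \<mu> (i + 1)) \<notin> F" by blast
  let ?v = "w i" and ?v' = "w (i + 1)" and ?u = "\<mu> i" and ?u' = "\<mu> (i + 1)"
  have edges: "(?v, ?u) \<in> E - E'" "(?v', ?u) \<in> E' - E" "(?v', ?u') \<in> E - E'"
    using \<mu>(1)[of i] \<mu>(2)[of i] \<mu>(1)[of "i + 1"] by auto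
  then have "{(?v, ?u), (?v', ?u'), (?v', ?u), (?v, ?u')} \<inter> F = {}"
    using i agree by auto
  \<comment> \<open>Since the chord is not in \<open>E - E'\<close>, it is missing from
    \<open>E\<close> (first alternative) or present in \<open>E'\<close> (second).\<close>
  then have "swappable F E ?v ?v' ?u ?u' \<or> swappable F E' ?v' ?v ?u ?u'"
    using edges chord[of i] unfolding swappable_def by auto
  with edges that show thesis by blast
qed

subsection \<open>Irreducibility and convergence\<close>

lemma set_pmf_row_pairs:
  assumes "n > 1"
  shows "set_pmf (pmf_of_set {(i, j). i \<in> {1..n} \<and> j \<in> {1..n} \<and> i \<noteq> j})
    = {(i, j). i \<in> {1..n::nat} \<and> j \<in> {1..n} \<and> i \<noteq> j}" (is "set_pmf (pmf_of_set ?P) = ?P")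
proof (rule set_pmf_of_set)
  have "(1, 2) \<in> ?P" using assms by simp
  then show "?P \<noteq> {}" by blast
  have "?P \<subseteq> {1..n} \<times> {1..n}" by auto
  then show "finite ?P" by (rule finite_subset) simp
qed

lemma set_pmf_trade_step:
  assumes "n > 1" "\<And>i j. finite (tradeable F E i j)" "Q 0"
  shows "set_pmf (trade_step (bounded_choices Q) n F E) =
    {apply_trade F E i j B | i j B.
      i \<in> {1..n} \<and> j \<in> {1..n} \<and> i \<noteq> j \<and> B \<in> bounded_choices Q F E i j}"
proof -
  have choices: "finite (bounded_choices Q F E i j)" "bounded_choices Q F E i j \<noteq> {}" for i j
  proof -
    show "finite (bounded_choices Q F E i j)"
      by (rule finite_subset[of _ "Pow (tradeable F E i j)"])
        (use assms(2) in \<open>auto simp: in_bounded_choices_iff\<close>)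
    have "adj_diff F E i j \<in> bounded_choices Q F E i j"
      using assms(3) by (simp add: in_bounded_choices_iff tradeable_def)
    then show "bounded_choices Q F E i j \<noteq> {}" by auto
  qed
  have "\<not> n \<le> 1" using assms(1) by simp
  then show ?thesis
    by (simp only: trade_step_def if_False set_bind_pmf set_pmf_row_pairs[OF assms(1)])
      (fastforce simp: set_pmf_of_set[OF choices(2) choices(1)])
qed

lemma apply_trade_swap:
  assumes "v \<noteq> v'" "swappable F E v v' u u'"
  shows "apply_trade F E v v' (insert u' (adj_diff F E v v' - {u}))
    = E - {(v, u), (v', u')} \<union> {(v', u), (v, u')}" (is "?L = ?R")
proof -
  have sub: "insert u' (adj_diff F E v v' - {u}) \<subseteq> tradeable F E v v'"
    using assms(2) by (auto simp: swappable_def tradeable_def in_adj_diff_iff)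
  have "(k, x) \<in> ?L \<longleftrightarrow> (k, x) \<in> ?R" for k x
  proof (cases "x \<in> tradeable F E v v'")
    case True
    then show ?thesis
      using assms unfolding in_apply_trade_iff[OF assms(1) sub]
      by (auto simp: swappable_def in_adj_diff_iff in_tradeable_iff)
  next
    case False
    moreover have "u \<in> tradeable F E v v'" "u' \<in> tradeable F E v v'"
      using assms(2) by (auto simp: swappable_def in_tradeable_iff)
    ultimately have "x \<noteq> u" "x \<noteq> u'" by auto
    with False show ?thesis
      unfolding in_apply_trade_iff[OF assms(1) sub] by simp
  qed
  then show ?thesis by auto
qed

text \<open>The new set contains exactly one element outside \<open>adj_diff\<close>, so
  \<open>Q 1\<close> admits every swap.\<close>

lemma swap_in_bounded_choices:
  assumes "finite (adj_diff F E v v')" "swappable F E v v' u u'" "Q 1"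
  shows "insert u' (adj_diff F E v v' - {u}) \<in> bounded_choices Q F E v v'"
proof -
  let ?D = "adj_diff F E v v'"
  have u: "u \<in> ?D" "u' \<notin> ?D" "u' \<in> adj_diff F E v' v"
    using assms(2) by (auto simp: swappable_def in_adj_diff_iff)
  then have "card (insert u' (?D - {u})) = card ?D"
    using assms(1) card_Suc_Diff1[OF assms(1) u(1)] by simp
  moreover have "insert u' (?D - {u}) - ?D = {u'}" using u by auto
  ultimately show ?thesis
    using u assms(3) by (auto simp: in_bounded_choices_iff tradeable_def)
qed

text \<open>At least two elements leave and at most one enters. Applied to symmetric differences,
  with \<open>e\<close> the pair that a swap may spoil.\<close>

lemma card_less_insert_Diff:
  assumes "finite X" "x \<in> X" "y \<in> X" "x \<noteq> y" "Y \<subseteq> insert e (X - {x, y})"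
  shows "card Y < card X"
proof -
  have "card {x, y} \<le> card X" using assms by (intro card_mono) auto
  moreover have "card Y \<le> card (insert e (X - {x, y}))"
    using assms by (intro card_mono) auto
  moreover have "card (insert e (X - {x, y})) \<le> Suc (card (X - {x, y}))"
    using assms(1) by (simp add: card_insert_if)
  moreover have "card (X - {x, y}) = card X - 2"
    using assms by (subst card_Diff_subset) auto
  ultimately show ?thesis using assms(4) by simp
qed

text \<open>\<open>Q 0\<close> makes the chain lazy, and \<open>Q 1\<close> admits the swaps that
  make it irreducible.\<close>

lemma trade_chain:
  assumes F: "F = F\<^sub>E \<union> F\<^sub>N" and no_matching: "\<not> has_matching_of_size F 3" and Q: "Q 0" "Q 1"
  shows "symmetric_chain (fixed_realisations n m a b F\<^sub>E F\<^sub>N) (trade_step (bounded_choices Q) n F)"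
proof -
  let ?S = "fixed_realisations n m a b F\<^sub>E F\<^sub>N" and ?K = "trade_step (bounded_choices Q) n F"
  let ?A = "{(x, y). x \<in> ?S \<and> y \<in> set_pmf (?K x)}"
  have S_sub: "E \<subseteq> vertex_pairs n m" if "E \<in> ?S" for E
    using that by (simp add: fixed_realisations_def)
  have fin: "finite E" if "E \<in> ?S" for E
    using S_sub[OF that] by (rule finite_subset) (simp add: vertex_pairs_def)
  have fin_diff: "finite (adj_diff F E i j)" if "E \<in> ?S" for E i j
    using fin[OF that] by (auto simp: adj_diff_def intro: finite_Image)
  then have fin_tr: "finite (tradeable F E i j)" if "E \<in> ?S" for E i j
    using that by (simp add: tradeable_def)
  have closed: "set_pmf (?K E) \<subseteq> ?S" if "E \<in> ?S" for E
  proof (cases "n > 1")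
    case True
    then show ?thesis
      unfolding set_pmf_trade_step[where Q = Q, OF True fin_tr[OF that] Q(1)]
      using apply_trade_closed[OF that _ _ _ F] by (auto simp: bounded_choices_def)
  qed (use that in \<open>simp add: trade_step_def\<close>)
  have symmetric: "pmf (?K E) E' = pmf (?K E') E" if "E \<in> ?S" "E' \<in> ?S" for E E'
  proof (cases "n > 1")
    case True
    then have "\<not> n \<le> 1" by simp
    then show ?thesis
      \<comment> \<open>The row pair is drawn independently of the state, so symmetry reduces to
        that of a trade between fixed rows.\<close>
      unfolding trade_step_def
      by (simp only: if_False, intro pmf_bind_pmf_cong, unfold set_pmf_row_pairs[OF True])
        (use fin_tr that Q(1) in \<open>auto intro!: pmf_map_trade_symmetric[where Q = Q]\<close>)
  qed (simp add: trade_step_def indicator_def)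
  have loop: "E \<in> set_pmf (?K E)" if "E \<in> ?S" for E
  proof (cases "n > 1")
    case True
    have "adj_diff F E 1 2 \<in> bounded_choices Q F E 1 2"
      using Q(1) by (simp add: in_bounded_choices_iff tradeable_def)
    moreover have "E = apply_trade F E 1 2 (adj_diff F E 1 2)"
      by (simp add: apply_trade_adj_diff)
    moreover have "1 \<in> {1..n}" "2 \<in> {1..n}" "(1::nat) \<noteq> 2"
      using True by auto
    ultimately show ?thesis
      unfolding set_pmf_trade_step[where Q = Q, OF True fin_tr[OF that] Q(1)] by blast
  qed (simp add: trade_step_def)
  have swap: "E - {(v, u), (v', u')} \<union> {(v', u), (v, u')} \<in> set_pmf (?K E)"
    if E: "E \<in> ?S" and sw: "swappable F E v v' u u'" for E v v' u u'
  proof -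
    have v: "v \<in> {1..n}" "v' \<in> {1..n}" "v \<noteq> v'"
      using sw S_sub[OF E] by (auto simp: swappable_def vertex_pairs_def)
    then have "n > 1" by auto
    show ?thesis
      unfolding set_pmf_trade_step[where Q = Q, OF \<open>n > 1\<close> fin_tr[OF E] Q(1)]
      using apply_trade_swap[OF v(3) sw] swap_in_bounded_choices[of F E v v' u u' Q]
        fin_diff[OF E] sw Q(2) v by blast
  qed
  \<comment> \<open>Needed to traverse backwards the swaps that are applied to \<open>E'\<close>
    instead of \<open>E\<close>.\<close>
  have sym_A: "sym ?A"
  proof (rule symI)
    fix E E' assume "(E, E') \<in> ?A"
    then have S: "E \<in> ?S" "E' \<in> ?S" and E': "E' \<in> set_pmf (?K E)"
      using closed by blast+
    from E' have "pmf (?K E') E \<noteq> 0" by (simp add: set_pmf_iff symmetric[OF S])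
    with S show "(E', E) \<in> ?A" by (simp add: set_pmf_iff)
  qed
  have irreducible: "(E, E') \<in> ?A\<^sup>*" if "E \<in> ?S" "E' \<in> ?S" for E E'
    using that
  proof (induction "card ((E - E') \<union> (E' - E))" arbitrary: E E' rule: less_induct)
    case less
    show ?case
    proof (cases "E = E'")
      case False
      let ?X = "(E - E') \<union> (E' - E)"
      have finX: "finite ?X" using fin less.prems by auto
      obtain v v' u u' where edges: "(v, u) \<in> E - E'" "(v', u) \<in> E' - E" "(v', u') \<in> E - E'"
        and sw: "swappable F E v v' u u' \<or> swappable F E' v' v u u'"
        by (rule exists_improving_swap[OF less.prems False F no_matching])
      have X: "(v, u) \<in> ?X" "(v', u) \<in> ?X" "(v, u) \<noteq> (v', u)" using edges by auto
      note less_X = card_less_insert_Diff[OF finX X, of _ "(v, u')"]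
      from sw show ?thesis
      proof
        let ?E1 = "E - {(v, u), (v', u')} \<union> {(v', u), (v, u')}"
        assume "swappable F E v v' u u'"
        from swap[OF less.prems(1) this] have A: "(E, ?E1) \<in> ?A"
          using less.prems(1) by blast
        then have E1: "?E1 \<in> ?S" using closed by blast
        have "card ((?E1 - E') \<union> (E' - ?E1)) < card ?X"
          using edges by (intro less_X) auto
        from less.hyps[OF this E1 less.prems(2)] A show ?thesis
          by (rule converse_rtrancl_into_rtrancl[rotated])
      next
        let ?E1 = "E' - {(v', u), (v, u')} \<union> {(v, u), (v', u')}"
        assume "swappable F E' v' v u u'"
        from swap[OF less.prems(2) this] have A: "(E', ?E1) \<in> ?A"
          using less.prems(2) by blast
        then have E1: "?E1 \<in> ?S" using closed by blast
        have "card ((E - ?E1) \<union> (?E1 - E)) < card ?X"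
          using edges by (intro less_X) auto
        from less.hyps[OF this less.prems(1) E1] symD[OF sym_A A] show ?thesis
          by (rule rtrancl_into_rtrancl)
      qed
    qed simp
  qed
  have "finite ?S"
    by (rule finite_subset[of _ "Pow (vertex_pairs n m)"])
      (use S_sub in \<open>auto simp: vertex_pairs_def\<close>)
  with closed symmetric loop irreducible show ?thesis
    by unfold_locales
qed

text \<open>Both rules admit exchanging zero or one element, which is all that
  \<open>trade_chain\<close> asks of \<open>Q\<close>.\<close>

theorem corollary1:
  fixes n m :: nat and a b :: "nat \<Rightarrow> nat" and F\<^sub>E F\<^sub>N F G :: pairs
  assumes "\<forall>i\<in>{1..n}. a i > 0" and "\<forall>j\<in>{1..m}. b j > 0"
    and "F\<^sub>E \<subseteq> vertex_pairs n m" and "F\<^sub>N \<subseteq> vertex_pairs n m"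
    and "F = F\<^sub>E \<union> F\<^sub>N"
    and "\<not> has_matching_of_size F 3"
    and "G \<in> fixed_realisations n m a b F\<^sub>E F\<^sub>N"
  shows "converges_to_uniform (\<lambda>t. swap_algorithm n F t G) (fixed_realisations n m a b F\<^sub>E F\<^sub>N)
    \<and> converges_to_uniform (\<lambda>t. curveball_algorithm n F t G) (fixed_realisations n m a b F\<^sub>E F\<^sub>N)"
  unfolding swap_algorithm_def curveball_algorithm_def swap_choices_eq curveball_choices_eq
  using assms(5-7) by (auto intro!: symmetric_chain.run_converges trade_chain)

end
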